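(* Let $K$ be a field and let $I\subset S:=K[x_1,x_2,x_3]$ be a monomial ideal which is not principal. If $I=I^{sat}$ then $\operatorname{sdepth}(I)=2$.
   Context: The saturation of $I$ is $I^{sat}=\bigcup_{k\geq 1}(I:(x_1,x_2,x_3)^k)$. The zero ideal counts as principal. $S$ is given the standard $\mathbb{Z}^3$-grading, with $\deg x_i$ the $i$-th unit vector. Let $M\neq 0$ be a finitely generated $\mathbb{Z}^3$-graded $S$-module. A Stanley decomposition of $M$ is a direct sum decomposition of $K$-vector spaces $\mathcal{D}: M=\bigoplus_{i=1}^r m_iK[Z_i]$ where each $m_i\in M$ is homogeneous, $Z_i\subset\{x_1,x_2,x_3\}$, and $m_iK[Z_i]$ is a free $K[Z_i]$-module. Put $\operatorname{sdepth}(\mathcal{D})=\min_{1\le i\le r}|Z_i|$. The Stanley depth of $M$ is $\operatorname{sdepth}(M)=\max\{\operatorname{sdepth}(\mathcal{D}) : \mathcal{D}\text{ a Stanley decomposition of }M\}$. *)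

theory Defs
  imports Complex_Main "HOL-Library.Poly_Mapping" "HOL-Library.Numeral_Type" "HOL-Library.FuncSet"
begin

section \<open>Polynomial rings and ideals\<close>

text \<open>
  Polynomials over \<open>'k\<close> in variables indexed by the finite type \<open>'x\<close>: finitely supported
  functions from exponent vectors to coefficients, with the convolution product.
\<close>

type_synonym ('x, 'k) mpoly = "('x \<Rightarrow>\<^sub>0 nat) \<Rightarrow>\<^sub>0 'k"

definition monomial :: "('x \<Rightarrow>\<^sub>0 nat) \<Rightarrow> ('x, 'k::field) mpoly" where
  "monomial a = Poly_Mapping.single a 1"

definition var :: "'x \<Rightarrow> ('x, 'k::field) mpoly" where
  "var i = monomial (Poly_Mapping.single i 1)"

text \<open>Ideals of a commutative ring are the submodules of the ring acting on itself.\<close>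

lemma module_mult: "module ((*) :: 'a::comm_ring_1 \<Rightarrow> 'a \<Rightarrow> 'a)"
  by unfold_locales (simp_all add: algebra_simps)

abbreviation ideal_gen :: "'a::comm_ring_1 set \<Rightarrow> 'a set" where
  "ideal_gen B \<equiv> module.span (*) B"

definition monomial_ideal :: "('x, 'k::field) mpoly set \<Rightarrow> bool" where
  "monomial_ideal I \<longleftrightarrow> (\<exists>A. I = ideal_gen (monomial ` A))"

text \<open>The zero ideal is principal (take \<open>f = 0\<close>), and so is the unit ideal.\<close>

definition principal_ideal :: "'a::comm_ring_1 set \<Rightarrow> bool" where
  "principal_ideal I \<longleftrightarrow> (\<exists>f. I = ideal_gen {f})"

definition ideal_power :: "'a::comm_ring_1 set \<Rightarrow> nat \<Rightarrow> 'a set" where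
  "ideal_power J k = ideal_gen {\<Prod>i<k. g i | g. \<forall>i<k. g i \<in> J}"

definition ideal_colon :: "'a::comm_ring_1 set \<Rightarrow> 'a set \<Rightarrow> 'a set" where
  "ideal_colon I J = {f. \<forall>g\<in>J. f * g \<in> I}"

definition saturation :: "('x, 'k::field) mpoly set \<Rightarrow> ('x, 'k) mpoly set" where
  "saturation I = (\<Union>k\<in>{1..}. ideal_colon I (ideal_power (ideal_gen (range var)) k))"


section \<open>Stanley decompositions\<close>

text \<open>
  The subring \<open>K[Z]\<close>; a set of variables is represented by the set \<open>Z\<close> of their indices.
\<close>

definition polys_in :: "'x set \<Rightarrow> ('x, 'k::field) mpoly set" where
  "polys_in Z = {f. \<forall>a \<in> Poly_Mapping.keys f. Poly_Mapping.keys a \<subseteq> Z}"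

text \<open>
  \<open>V\<close> is a free module over the subring \<open>R\<close> of the scalar ring, i.e. it has a basis.
  (HOL's \<open>module.independent\<close> only speaks about scalars ranging over a whole type.)
\<close>

definition free_over :: "'a::comm_ring_1 set \<Rightarrow> ('a \<Rightarrow> 'm::ab_group_add \<Rightarrow> 'm) \<Rightarrow> 'm set \<Rightarrow> bool" where
  "free_over R scale V \<longleftrightarrow> (\<exists>B \<subseteq> V.
     (\<forall>T c. finite T \<and> T \<subseteq> B \<and> c ` T \<subseteq> R \<and> (\<Sum>b\<in>T. scale (c b) b) = 0 \<longrightarrow> (\<forall>b\<in>T. c b = 0)) \<and>
     V = {\<Sum>b\<in>T. scale (c b) b | T c. finite T \<and> T \<subseteq> B \<and> c ` T \<subseteq> R})"

definition stanley_space ::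
  "(('x, 'k::field) mpoly \<Rightarrow> 'm::ab_group_add \<Rightarrow> 'm) \<Rightarrow> 'm \<Rightarrow> 'x set \<Rightarrow> 'm set" where
  "stanley_space scale m Z = (\<lambda>f. scale f m) ` polys_in Z"

text \<open>
  \<open>M\<close> is the internal direct sum of its subgroups \<open>V 0, \<dots>, V (n - 1)\<close>:
  the summation map from their product to \<open>M\<close> is bijective.
\<close>

definition is_direct_sum :: "nat \<Rightarrow> (nat \<Rightarrow> 'm::ab_group_add set) \<Rightarrow> 'm set \<Rightarrow> bool" where
  "is_direct_sum n V M \<longleftrightarrow> bij_betw (\<lambda>s. \<Sum>i<n. s i) (Pi\<^sub>E {..<n} V) M"

text \<open>
  The following notions are meant for a nonzero finitely generated multigraded module \<open>M\<close>
  over the polynomial ring (\<open>M\<close> a subset of the type \<open>'m\<close>), where \<open>scale\<close> is the action and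
  \<open>piece d\<close> is the homogeneous component of \<open>M\<close> of degree \<open>d\<close>.
  The entries of the list \<open>D\<close> are the pairs of \<open>m\<^sub>i\<close> and \<open>Z\<^sub>i\<close>.
\<close>

definition stanley_decomposition ::
  "(('x::finite, 'k::field) mpoly \<Rightarrow> 'm::ab_group_add \<Rightarrow> 'm) \<Rightarrow> (('x \<Rightarrow> int) \<Rightarrow> 'm set) \<Rightarrow> 'm set
    \<Rightarrow> ('m \<times> 'x set) list \<Rightarrow> bool" where
  "stanley_decomposition scale piece M D \<longleftrightarrow>
     (\<forall>(m, Z) \<in> set D. m \<in> M \<and> (\<exists>d. m \<in> piece d) \<and>
        free_over (polys_in Z) scale (stanley_space scale m Z)) \<and>
     is_direct_sum (length D) (\<lambda>i. stanley_space scale (fst (D ! i)) (snd (D ! i))) M"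

definition decomposition_sdepth :: "('m \<times> 'x::finite set) list \<Rightarrow> nat" where
  "decomposition_sdepth D = Min ((\<lambda>(m, Z). card Z) ` set D)"

definition sdepth ::
  "(('x::finite, 'k::field) mpoly \<Rightarrow> 'm::ab_group_add \<Rightarrow> 'm) \<Rightarrow> (('x \<Rightarrow> int) \<Rightarrow> 'm set) \<Rightarrow> 'm set
    \<Rightarrow> nat" where
  "sdepth scale piece M = Max {decomposition_sdepth D | D. stanley_decomposition scale piece M D}"

text \<open>The standard multigrading of the polynomial ring, and the induced one on monomial ideals.\<close>

definition graded_component :: "('x \<Rightarrow> int) \<Rightarrow> ('x, 'k::field) mpoly set" where
  "graded_component d =
     {f. \<forall>a \<in> Poly_Mapping.keys f. \<forall>i. int (Poly_Mapping.lookup a i) = d i}"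

definition ideal_sdepth :: "('x::finite, 'k::field) mpoly set \<Rightarrow> nat" where
  "ideal_sdepth I = sdepth (*) (\<lambda>d. I \<inter> graded_component d) I"

end

theory Submission
  imports Defs "HOL-Analysis.Cartesian_Space" "HOL-Library.Disjoint_Sets"
begin

text \<open>
  A monomial ideal is an upward closed set \<open>U\<close> of exponent vectors, and it is saturated iff a
  vector lies in \<open>U\<close> as soon as it can be moved into \<open>U\<close> along each coordinate direction.
  Sliced by the third exponent, \<open>U\<close> is an increasing, eventually constant sequence of planar sets,
  and the vectors entering at level \<open>c\<close> stay in \<open>U\<close> from then on. By saturation the vectors
  entering at one level form finitely many axis-parallel rays (and a quadrant at the first nonempty
  level); extended in the third direction they are Stanley spaces of dimension at least 2.
  Conversely, two three-dimensional Stanley spaces always intersect, so a decomposition into these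
  has a single nonzero summand and the ideal is principal.
\<close>


section \<open>Monomial ideals as sets of exponent vectors\<close>

text \<open>Monomial ideals and Stanley spaces of monomials both have this form, so questions about
  either become questions about sets of exponent vectors.\<close>

definition polys_on :: "('x \<Rightarrow>\<^sub>0 nat) set \<Rightarrow> ('x, 'k::field) mpoly set" where
  "polys_on U = {f. Poly_Mapping.keys f \<subseteq> U}"

definition add_closed :: "'a::monoid_add set \<Rightarrow> bool" where
  "add_closed U \<longleftrightarrow> (\<forall>v\<in>U. \<forall>d. v + d \<in> U)"

lemma monomial_mem_polys_on: "(monomial v :: ('x, 'k::field) mpoly) \<in> polys_on U \<longleftrightarrow> v \<in> U"
  by (simp add: monomial_def polys_on_def)

lemma polys_on_mult:
  assumes "\<And>a b. a \<in> U \<Longrightarrow> b \<in> V \<Longrightarrow> a + b \<in> W" and "f \<in> polys_on U" "g \<in> polys_on V"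
  shows "f * g \<in> polys_on W"
  using assms keys_mult[of f g] unfolding polys_on_def by blast

lemma sum_polys_on: "(\<And>i. i \<in> A \<Longrightarrow> f i \<in> polys_on U) \<Longrightarrow> sum f A \<in> polys_on U"
  using keys_add by (induction A rule: infinite_finite_induct) (fastforce simp: polys_on_def)+

lemma sum_singles_keys:
  "(\<Sum>k\<in>Poly_Mapping.keys f. Poly_Mapping.single k (Poly_Mapping.lookup f k)) = f"
  by (rule poly_mapping_eqI)
    (simp add: lookup_sum lookup_single when_def sum.delta' in_keys_iff)

text \<open>For an upward closed \<open>U\<close> the set \<open>polys_on U\<close> is itself an
  ideal, so it contains everything generated by its elements.\<close>

lemma ideal_gen_subset_polys_on:
  fixes B :: "('x, 'k::field) mpoly set"
  assumes "add_closed U" "B \<subseteq> polys_on U"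
  shows "ideal_gen B \<subseteq> polys_on U"
proof -
  interpret module "(*) :: ('x, 'k) mpoly \<Rightarrow> _" by (rule module_mult)
  have "f * g \<in> polys_on U" if "g \<in> polys_on U" for f g :: "('x, 'k) mpoly"
  proof (rule polys_on_mult[OF _ _ that])
    show "a + b \<in> U" if "a \<in> UNIV" "b \<in> U" for a b
      using assms(1) that(2) unfolding add_closed_def by (metis add.commute)
  qed (simp add: polys_on_def)
  moreover have "f + g \<in> polys_on U" if "f \<in> polys_on U" "g \<in> polys_on U" for f g :: "('x, 'k) mpoly"
    using that keys_add[of f g] by (auto simp: polys_on_def)
  ultimately have "subspace (polys_on U)"
    by (auto simp: subspace_def polys_on_def)
  with assms(2) show ?thesis by (rule span_minimal)
qed

lemma polys_on_subset_ideal_gen: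
  fixes B :: "('x, 'k::field) mpoly set"
  assumes "\<And>v. v \<in> U \<Longrightarrow> monomial v \<in> ideal_gen B"
  shows "polys_on U \<subseteq> ideal_gen B"
proof
  interpret module "(*) :: ('x, 'k) mpoly \<Rightarrow> _" by (rule module_mult)
  fix f :: "('x, 'k) mpoly" assume f: "f \<in> polys_on U"
  have "Poly_Mapping.single k (Poly_Mapping.lookup f k) \<in> span B" if "k \<in> Poly_Mapping.keys f" for k
  proof -
    have "Poly_Mapping.single k (Poly_Mapping.lookup f k)
        = Poly_Mapping.single 0 (Poly_Mapping.lookup f k) * monomial k"
      by (simp add: monomial_def mult_single)
    then show ?thesis
      using assms f that by (auto simp: polys_on_def intro!: span_scale)
  qed
  then have "(\<Sum>k\<in>Poly_Mapping.keys f. Poly_Mapping.single k (Poly_Mapping.lookup f k)) \<in> span B"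
    by (rule span_sum)
  then show "f \<in> span B"
    by (simp add: sum_singles_keys)
qed

lemma monomial_ideal_polys_on:
  fixes I :: "('x, 'k::field) mpoly set"
  assumes "monomial_ideal I"
  obtains U where "add_closed U" "I = polys_on U"
proof -
  interpret module "(*) :: ('x, 'k) mpoly \<Rightarrow> _" by (rule module_mult)
  obtain A where A: "I = span (monomial ` A)"
    using assms by (auto simp: monomial_ideal_def)
  \<comment> \<open>The exponents of all monomial multiples of the given generators.\<close>
  define U where "U = {a + d | a d. a \<in> A}"
  have closed: "add_closed U"
    unfolding add_closed_def U_def by (auto simp: add.assoc) blast
  have "monomial ` A \<subseteq> polys_on U"
    unfolding U_def by (auto simp: monomial_mem_polys_on) (metis add.right_neutral)
  moreover have "monomial (a + d) \<in> span (monomial ` A)" if "a \<in> A" for a d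
  proof -
    have "(monomial (a + d) :: ('x, 'k) mpoly) = monomial d * monomial a"
      by (simp add: monomial_def mult_single add.commute)
    also have "\<dots> \<in> span (monomial ` A)"
      using that by (intro span_scale span_base imageI)
    finally show ?thesis .
  qed
  then have "polys_on U \<subseteq> span (monomial ` A)"
    by (intro polys_on_subset_ideal_gen) (auto simp: U_def)
  ultimately have "I = polys_on U"
    using ideal_gen_subset_polys_on[OF closed] A by blast
  with closed that show ?thesis by blast
qed


section \<open>Saturated monomial ideals\<close>

lemma add_closed_degree_ge:
  "add_closed {v :: 'x::finite \<Rightarrow>\<^sub>0 nat. k \<le> (\<Sum>i\<in>UNIV. Poly_Mapping.lookup v i)}"
  by (auto simp: add_closed_def lookup_add sum.distrib)

text \<open>Elements of the ideal of the variables have no constant term, so each factor raises the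
  least total degree by at least one.\<close>

lemma ideal_power_vars_subset:
  "ideal_power (ideal_gen (range var)) k
    \<subseteq> (polys_on {v. k \<le> (\<Sum>i\<in>UNIV. Poly_Mapping.lookup v i)} :: ('x::finite, 'k::field) mpoly set)"
    (is "_ \<subseteq> polys_on (?V k)")
  unfolding ideal_power_def
proof (rule ideal_gen_subset_polys_on[OF add_closed_degree_ge], clarify)
  fix g :: "nat \<Rightarrow> ('x, 'k) mpoly"
  assume g: "\<forall>i<k. g i \<in> ideal_gen (range var)"
  have "ideal_gen (range var) \<subseteq> (polys_on (?V 1) :: ('x, 'k) mpoly set)"
    by (rule ideal_gen_subset_polys_on[OF add_closed_degree_ge])
      (auto simp: var_def monomial_mem_polys_on lookup_single when_def)
  then have g: "g i \<in> polys_on (?V 1)" if "i < k" for i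
    using g that by blast
  have "(\<Prod>i<j. g i) \<in> polys_on (?V j)" if "j \<le> k" for j
    using that
  proof (induction j)
    case (Suc j)
    then have "(\<Prod>i<j. g i) \<in> polys_on (?V j)" by simp
    with Suc.prems g show ?case
      by (auto simp: lookup_add sum.distrib intro!: polys_on_mult[of "?V j" "?V 1"])
  qed (auto simp: polys_on_def)
  then show "(\<Prod>i<k. g i) \<in> polys_on (?V k)" by blast
qed

text \<open>A monomial of large total degree is divisible by a large power of some variable, so
  multiplying by it moves \<open>v\<close> into \<open>U\<close>.\<close>

lemma saturated_polys_on:
  fixes U :: "('x::finite \<Rightarrow>\<^sub>0 nat) set"
  assumes closed: "add_closed U"
    and sat: "(polys_on U :: ('x, 'k::field) mpoly set) = saturation (polys_on U)"
    and dir: "\<And>i. \<exists>k. v + Poly_Mapping.single i k \<in> U"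
  shows "v \<in> U"
proof -
  obtain k where k: "\<And>i. v + Poly_Mapping.single i (k i) \<in> U"
    using dir by metis
  \<comment> \<open>If every coordinate of \<open>d\<close> were at most \<open>k i\<close>, its
    degree would be below \<open>N\<close>. The summand 1 also makes \<open>N\<close> an admissible
    exponent in \<open>saturation\<close>, whose union starts at 1.\<close>
  define N where "N = (\<Sum>i\<in>UNIV. k i) + 1"
  let ?deg = "\<lambda>d :: 'x \<Rightarrow>\<^sub>0 nat. \<Sum>i\<in>UNIV. Poly_Mapping.lookup d i"
  have "v + d \<in> U" if deg: "N \<le> ?deg d" for d
  proof -
    obtain i where i: "k i \<le> Poly_Mapping.lookup d i"
    proof (rule ccontr)
      assume "\<not> thesis"
      with that have "Poly_Mapping.lookup d i \<le> k i" for i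
        by (meson nat_le_linear)
      then have "?deg d \<le> (\<Sum>i\<in>UNIV. k i)"
        by (intro sum_mono)
      with deg show False by (simp add: N_def)
    qed
    have "d = Poly_Mapping.single i (k i) + (d - Poly_Mapping.single i (k i))"
      using i by (intro poly_mapping_eqI) (auto simp: lookup_add lookup_minus lookup_single when_def)
    then have "v + d = (v + Poly_Mapping.single i (k i)) + (d - Poly_Mapping.single i (k i))"
      by (metis add.assoc)
    then show ?thesis
      using closed k unfolding add_closed_def by metis
  qed
  then have "monomial v * g \<in> polys_on U"
    if "g \<in> ideal_power (ideal_gen (range var)) N" for g :: "('x, 'k) mpoly"
    using that ideal_power_vars_subset
    by (intro polys_on_mult[of "{v}" "{d. N \<le> ?deg d}"]) (auto simp: monomial_mem_polys_on)
  then have "(monomial v :: ('x, 'k) mpoly) \<in> saturation (polys_on U)"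
    by (auto simp: saturation_def ideal_colon_def N_def intro!: bexI[of _ N])
  then show ?thesis
    using sat by (simp add: monomial_mem_polys_on[symmetric, where 'k='k])
qed


section \<open>Stanley spaces\<close>

text \<open>The exponents of the monomials in \<open>x^v K[Z]\<close>.\<close>

definition cone :: "('x \<Rightarrow>\<^sub>0 nat) \<Rightarrow> 'x set \<Rightarrow> ('x \<Rightarrow>\<^sub>0 nat) set" where
  "cone v Z = {v + d | d. Poly_Mapping.keys d \<subseteq> Z}"

lemma vertex_in_cone: "v \<in> cone v Z"
  by (auto simp: cone_def intro: exI[of _ 0])

lemma mem_cone_iff:
  "w \<in> cone v Z \<longleftrightarrow> (\<forall>i. if i \<in> Z then Poly_Mapping.lookup v i \<le> Poly_Mapping.lookup w i
                        else Poly_Mapping.lookup w i = Poly_Mapping.lookup v i)" (is "_ \<longleftrightarrow> ?P")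
proof
  assume "w \<in> cone v Z"
  then show ?P
    by (auto simp: cone_def lookup_add in_keys_iff)
next
  assume P: ?P
  then have le: "Poly_Mapping.lookup v i \<le> Poly_Mapping.lookup w i" for i
    using spec[OF P, of i] by (simp split: if_splits)
  have "w = v + (w - v)"
    using le by (intro poly_mapping_eqI) (simp add: lookup_add lookup_minus)
  moreover have "Poly_Mapping.keys (w - v) \<subseteq> Z"
  proof
    fix i assume "i \<in> Poly_Mapping.keys (w - v)"
    with spec[OF P, of i] show "i \<in> Z"
      by (simp add: in_keys_iff lookup_minus split: if_splits)
  qed
  ultimately show "w \<in> cone v Z"
    unfolding cone_def by blast
qed

lemma stanley_space_monomial:
  "stanley_space (*) (monomial v :: ('x, 'k::field) mpoly) Z = polys_on (cone v Z)"
proof (intro equalityI subsetI)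
  fix f :: "('x, 'k) mpoly" assume "f \<in> stanley_space (*) (monomial v) Z"
  then obtain g where g: "g \<in> polys_in Z" and f: "f = g * monomial v"
    by (auto simp: stanley_space_def)
  show "f \<in> polys_on (cone v Z)"
    unfolding f
  proof (rule polys_on_mult)
    show "g \<in> polys_on {d. Poly_Mapping.keys d \<subseteq> Z}"
      using g by (auto simp: polys_in_def polys_on_def)
    show "monomial v \<in> polys_on {v}"
      by (simp add: monomial_mem_polys_on)
    show "a + b \<in> cone v Z" if "a \<in> {d. Poly_Mapping.keys d \<subseteq> Z}" "b \<in> {v}" for a b
      using that add.commute[of a v] unfolding cone_def by blast
  qed
next
  fix f :: "('x, 'k) mpoly" assume f: "f \<in> polys_on (cone v Z)"
  \<comment> \<open>\<open>g\<close> is \<open>f\<close> divided by the monomial. The truncated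
    subtraction \<open>k - v\<close> is exact because every exponent of \<open>f\<close> lies in the
    cone at \<open>v\<close>.\<close>
  define g :: "('x, 'k) mpoly"
    where "g = (\<Sum>k\<in>Poly_Mapping.keys f. Poly_Mapping.single (k - v) (Poly_Mapping.lookup f k))"
  have k: "k - v + v = k \<and> Poly_Mapping.keys (k - v) \<subseteq> Z" if k: "k \<in> Poly_Mapping.keys f" for k
  proof -
    obtain d where "k = v + d" "Poly_Mapping.keys d \<subseteq> Z"
      using f k unfolding polys_on_def cone_def by blast
    then show ?thesis by (simp add: add.commute)
  qed
  have "g * monomial v = (\<Sum>k\<in>Poly_Mapping.keys f. Poly_Mapping.single k (Poly_Mapping.lookup f k))"
    unfolding g_def sum_distrib_right
    by (rule sum.cong) (auto simp: monomial_def mult_single k)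
  moreover have "g \<in> polys_on {d. Poly_Mapping.keys d \<subseteq> Z}"
    unfolding g_def by (rule sum_polys_on) (use k in \<open>auto simp: polys_on_def split: if_splits\<close>)
  ultimately show "f \<in> stanley_space (*) (monomial v) Z"
    unfolding stanley_space_def sum_singles_keys
    by (intro image_eqI[of _ _ g]) (auto simp: polys_on_def polys_in_def)
qed

text \<open>Multiplication by a monomial only shifts exponents, so every coefficient of
  \<open>f\<close> reappears in the product.\<close>

lemma mult_monomial_eq_0_iff: "f * monomial v = 0 \<longleftrightarrow> (f :: ('x, 'k::field) mpoly) = 0"
proof
  assume f: "f * monomial v = 0"
  have "Poly_Mapping.lookup f a = 0" for a
  proof -
    have "f * monomial v = (\<Sum>k\<in>Poly_Mapping.keys f. Poly_Mapping.single (k + v) (Poly_Mapping.lookup f k))"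
      by (subst sum_singles_keys[of f, symmetric])
        (simp add: sum_distrib_right monomial_def mult_single)
    then have "Poly_Mapping.lookup (f * monomial v) (a + v) = Poly_Mapping.lookup f a"
      by (simp add: lookup_sum lookup_single when_def in_keys_iff)
    with f show ?thesis by simp
  qed
  then show "f = 0" by (intro poly_mapping_eqI) simp
qed simp

lemma free_over_stanley_space_monomial:
  "free_over (polys_in Z) (*) (stanley_space (*) (monomial v :: ('x, 'k::field) mpoly) Z)"
proof -
  let ?m = "monomial v :: ('x, 'k) mpoly"
  have sub: "T = {} \<or> T = {?m}" if "T \<subseteq> {?m}" for T
    using that by blast
  have "1 \<in> (polys_in Z :: ('x, 'k) mpoly set)"
    by (simp add: polys_in_def)
  then have "?m \<in> stanley_space (*) ?m Z"
    unfolding stanley_space_def by (rule image_eqI[rotated]) simp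
  moreover have "\<forall>b\<in>T. c b = 0" if "T \<subseteq> {?m}" "(\<Sum>b\<in>T. c b * b) = 0" for T c
    using sub[OF that(1)] that(2) by (auto simp: mult_monomial_eq_0_iff)
  moreover have "stanley_space (*) ?m Z
      = {\<Sum>b\<in>T. c b * b | T c. finite T \<and> T \<subseteq> {?m} \<and> c ` T \<subseteq> polys_in Z}" (is "_ = ?R")
  proof (intro equalityI subsetI)
    fix f assume "f \<in> stanley_space (*) ?m Z"
    then obtain g where "g \<in> polys_in Z" "f = g * ?m"
      by (auto simp: stanley_space_def)
    then show "f \<in> ?R"
      by (intro CollectI exI[of _ "{?m}"] exI[of _ "\<lambda>_. g"]) auto
  next
    fix f assume "f \<in> ?R"
    then obtain T c where T: "T \<subseteq> {?m}" "c ` T \<subseteq> polys_in Z" "f = (\<Sum>b\<in>T. c b * b)"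
      by blast
    have "0 \<in> (polys_in Z :: ('x, 'k) mpoly set)"
      by (simp add: polys_in_def)
    then have "0 \<in> stanley_space (*) ?m Z"
      unfolding stanley_space_def by (rule image_eqI[rotated]) simp
    then show "f \<in> stanley_space (*) ?m Z"
      using sub[OF T(1)] T(2,3) by (auto simp: stanley_space_def)
  qed
  ultimately show ?thesis
    unfolding free_over_def by (intro exI[of _ "{?m}"]) blast
qed

text \<open>Each exponent belongs to at most one \<open>C i\<close>, so the coefficients of a sum
  determine its summands. Conversely, a polynomial is split by sorting its terms according to the
  sets \<open>C i\<close>.\<close>

lemma is_direct_sum_polys_on:
  fixes C :: "nat \<Rightarrow> ('x \<Rightarrow>\<^sub>0 nat) set"
  assumes disj: "disjoint_family_on C {..<n}"
  shows "is_direct_sum n (\<lambda>i. polys_on (C i)) (polys_on (\<Union>i<n. C i) :: ('x, 'k::field) mpoly set)"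
  unfolding is_direct_sum_def
proof (rule bij_betw_imageI)
  let ?P = "Pi\<^sub>E {..<n} (\<lambda>i. polys_on (C i)) :: (nat \<Rightarrow> ('x, 'k) mpoly) set"
  have zero: "Poly_Mapping.lookup (s i) w = 0" if "s \<in> ?P" "i < n" "w \<notin> C i" for s i w
    using that by (fastforce simp: polys_on_def PiE_iff in_keys_iff)
  have coeff: "Poly_Mapping.lookup (\<Sum>i<n. s i) w = Poly_Mapping.lookup (s j) w"
    if s: "s \<in> ?P" and j: "j < n" "w \<in> C j" for s j w
  proof -
    have "w \<notin> C i" if "i < n" "i \<noteq> j" for i
      using disj j that by (auto simp: disjoint_family_on_def)
    then have "(\<Sum>i<n. Poly_Mapping.lookup (s i) w) = (\<Sum>i<n. if i = j then Poly_Mapping.lookup (s j) w else 0)"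
      using zero[OF s] by (intro sum.cong) auto
    then show ?thesis
      using j by (simp add: lookup_sum)
  qed
  show "inj_on (\<lambda>s. \<Sum>i<n. s i) ?P"
  proof (rule inj_onI)
    fix s t assume s: "s \<in> ?P" and t: "t \<in> ?P" and eq: "(\<Sum>i<n. s i) = (\<Sum>i<n. t i)"
    have "Poly_Mapping.lookup (s j) w = Poly_Mapping.lookup (t j) w" if "j < n" for j w
      using coeff[OF s that] coeff[OF t that] zero[OF s that] zero[OF t that] eq
      by (cases "w \<in> C j") auto
    then have "s j = t j" if "j < n" for j
      using that by (intro poly_mapping_eqI) auto
    then show "s = t"
      by (intro PiE_ext[OF s t]) auto
  qed
  show "(\<lambda>s. \<Sum>i<n. s i) ` ?P = polys_on (\<Union>i<n. C i)"
  proof (intro equalityI subsetI)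
    fix f :: "('x, 'k) mpoly" assume "f \<in> (\<lambda>s. \<Sum>i<n. s i) ` ?P"
    then obtain s where s: "s \<in> ?P" "f = (\<Sum>i<n. s i)" by blast
    have "s i \<in> polys_on (\<Union>i<n. C i)" if "i < n" for i
      using s(1) that by (fastforce simp: polys_on_def PiE_iff)
    then show "f \<in> polys_on (\<Union>i<n. C i)"
      unfolding s(2) by (intro sum_polys_on) auto
  next
    fix f :: "('x, 'k) mpoly" assume f: "f \<in> polys_on (\<Union>i<n. C i)"
    define s where "s = (\<lambda>i\<in>{..<n}. \<Sum>k\<in>Poly_Mapping.keys f \<inter> C i.
      Poly_Mapping.single k (Poly_Mapping.lookup f k))"
    have s: "s \<in> ?P"
      unfolding s_def by (intro restrict_PiE_iff[THEN iffD2] ballI sum_polys_on) (auto simp: polys_on_def)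
    have "(\<Sum>i<n. s i) = (\<Sum>k\<in>(\<Union>i<n. Poly_Mapping.keys f \<inter> C i). Poly_Mapping.single k (Poly_Mapping.lookup f k))"
      unfolding s_def
      by (subst sum.UNION_disjoint) (use disj in \<open>auto simp: disjoint_family_on_def\<close>)
    also have "(\<Union>i<n. Poly_Mapping.keys f \<inter> C i) = Poly_Mapping.keys f"
      using f by (auto simp: polys_on_def)
    finally have "f = (\<Sum>i<n. s i)"
      by (simp add: sum_singles_keys)
    with s show "f \<in> (\<lambda>s. \<Sum>i<n. s i) ` ?P" by blast
  qed
qed


section \<open>Partitions into cones\<close>

definition cone_partitionable :: "nat \<Rightarrow> ('x \<Rightarrow>\<^sub>0 nat) set \<Rightarrow> bool" where
  "cone_partitionable k T \<longleftrightarrow> (\<exists>C. finite C \<and> (\<forall>(v, Z)\<in>C. k \<le> card Z) \<and>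
     disjoint_family_on (\<lambda>(v, Z). cone v Z) C \<and> T = (\<Union>(v, Z)\<in>C. cone v Z))"

lemma cone_partitionable_empty: "cone_partitionable k {}"
  unfolding cone_partitionable_def by (intro exI[of _ "{}"]) (simp add: disjoint_family_on_def)

lemma cone_partitionable_cone: "k \<le> card Z \<Longrightarrow> cone_partitionable k (cone v Z)"
  unfolding cone_partitionable_def by (intro exI[of _ "{(v, Z)}"]) (simp add: disjoint_family_on_def)

lemma cone_partitionable_Un:
  assumes "cone_partitionable k S" "cone_partitionable k T" "S \<inter> T = {}"
  shows "cone_partitionable k (S \<union> T)"
proof -
  obtain C D where C: "finite C" "\<forall>(v, Z)\<in>C. k \<le> card Z"
      "disjoint_family_on (\<lambda>(v, Z). cone v Z) C" "S = (\<Union>(v, Z)\<in>C. cone v Z)"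
    and D: "finite D" "\<forall>(v, Z)\<in>D. k \<le> card Z"
      "disjoint_family_on (\<lambda>(v, Z). cone v Z) D" "T = (\<Union>(v, Z)\<in>D. cone v Z)"
    using assms(1,2) unfolding cone_partitionable_def by auto
  have CD: "(case p of (v, Z) \<Rightarrow> cone v Z) \<inter> (case q of (v, Z) \<Rightarrow> cone v Z) = {}"
    if "p \<in> C" "q \<in> D" for p q
    using that assms(3) unfolding C(4) D(4) by blast
  have "disjoint_family_on (\<lambda>(v, Z). cone v Z) (C \<union> D)"
    unfolding disjoint_family_on_def
  proof (intro ballI impI)
    fix p q assume "p \<in> C \<union> D" "q \<in> C \<union> D" "p \<noteq> q"
    then consider "p \<in> C" "q \<in> C" | "p \<in> D" "q \<in> D" | "p \<in> C" "q \<in> D" | "q \<in> C" "p \<in> D"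
      by blast
    then show "(case p of (v, Z) \<Rightarrow> cone v Z) \<inter> (case q of (v, Z) \<Rightarrow> cone v Z) = {}"
      using disjoint_family_onD[OF C(3) _ _ \<open>p \<noteq> q\<close>] disjoint_family_onD[OF D(3) _ _ \<open>p \<noteq> q\<close>]
        CD[of p q] CD[of q p]
      by cases (simp_all add: Int_commute)
  qed
  moreover have "S \<union> T = (\<Union>(v, Z)\<in>C \<union> D. cone v Z)"
    unfolding C(4) D(4) by blast
  ultimately show ?thesis
    unfolding cone_partitionable_def using C(1,2) D(1,2)
    by (intro exI[of _ "C \<union> D"]) auto
qed

lemma cone_partitionable_stanley_decomposition:
  fixes U :: "('x::finite \<Rightarrow>\<^sub>0 nat) set"
  assumes "cone_partitionable k U"
  obtains D where "stanley_decomposition (*) (\<lambda>d. polys_on U \<inter> graded_component d)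
      (polys_on U :: ('x, 'k::field) mpoly set) D" "\<forall>(m, Z)\<in>set D. k \<le> card Z"
proof -
  obtain C where C: "finite C" "\<forall>(v, Z)\<in>C. k \<le> card Z"
      "disjoint_family_on (\<lambda>(v, Z). cone v Z) C" "U = (\<Union>(v, Z)\<in>C. cone v Z)"
    using assms unfolding cone_partitionable_def by auto
  \<comment> \<open>A list without repetitions turns disjointness over pairs into disjointness over
    positions, by which \<open>is_direct_sum\<close> numbers its summands.\<close>
  obtain L where L: "set L = C" "distinct L"
    using finite_distinct_list[OF C(1)] by blast
  define D where "D = map (\<lambda>(v, Z). (monomial v :: ('x, 'k) mpoly, Z)) L"
  let ?c = "\<lambda>i. case L ! i of (v, Z) \<Rightarrow> cone v Z"
  have "disjoint_family_on ?c {..<length L}"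
    unfolding disjoint_family_on_def[of _ "{..<_}"]
  proof (intro ballI impI)
    fix i j assume ij: "i \<in> {..<length L}" "j \<in> {..<length L}" "i \<noteq> j"
    have "L ! i \<in> C" "L ! j \<in> C"
      unfolding L(1)[symmetric] using ij by simp_all
    moreover have "L ! i \<noteq> L ! j"
      using ij L(2) by (simp add: nth_eq_iff_index_eq)
    ultimately show "?c i \<inter> ?c j = {}"
      by (rule disjoint_family_onD[OF C(3)])
  qed
  moreover have "U = (\<Union>i<length L. ?c i)"
    unfolding C(4) L(1)[symmetric] by (force simp: in_set_conv_nth)
  ultimately have "is_direct_sum (length L) (\<lambda>i. polys_on (?c i)) (polys_on U :: ('x, 'k) mpoly set)"
    by (simp add: is_direct_sum_polys_on)
  moreover have "length D = length L"
    by (simp add: D_def)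
  moreover have "Pi\<^sub>E {..<length L} (\<lambda>i. stanley_space (*) (fst (D ! i)) (snd (D ! i)))
      = Pi\<^sub>E {..<length L} (\<lambda>i. polys_on (?c i))"
    by (rule PiE_cong) (simp add: D_def stanley_space_monomial split: prod.split)
  ultimately have "is_direct_sum (length D) (\<lambda>i. stanley_space (*) (fst (D ! i)) (snd (D ! i))) (polys_on U)"
    unfolding is_direct_sum_def by simp
  moreover have "m \<in> polys_on U \<and> (\<exists>d. m \<in> polys_on U \<inter> graded_component d) \<and>
      free_over (polys_in Z) (*) (stanley_space (*) m Z)" if mZ: "(m, Z) \<in> set D" for m Z
  proof -
    obtain v where v: "m = monomial v" "(v, Z) \<in> C"
      using mZ L(1) by (auto simp: D_def)
    then have "v \<in> U"
      unfolding C(4) using vertex_in_cone by fastforce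
    moreover have "m \<in> graded_component (\<lambda>i. int (Poly_Mapping.lookup v i))"
      by (simp add: v graded_component_def monomial_def)
    ultimately show ?thesis
      by (auto simp: v monomial_mem_polys_on free_over_stanley_space_monomial)
  qed
  ultimately have "stanley_decomposition (*) (\<lambda>d. polys_on U \<inter> graded_component d) (polys_on U) D"
    unfolding stanley_decomposition_def by blast
  moreover have "\<forall>(m, Z)\<in>set D. k \<le> card Z"
    using C(2) L(1) by (auto simp: D_def)
  ultimately show ?thesis by (rule that)
qed


section \<open>Saturated sets in three variables\<close>

definition exps3 :: "(nat \<Rightarrow> nat \<Rightarrow> nat \<Rightarrow> bool) \<Rightarrow> (3 \<Rightarrow>\<^sub>0 nat) set" where
  "exps3 P = {v. P (Poly_Mapping.lookup v 1) (Poly_Mapping.lookup v 2) (Poly_Mapping.lookup v 3)}"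

definition vec3 :: "nat \<Rightarrow> nat \<Rightarrow> nat \<Rightarrow> (3 \<Rightarrow>\<^sub>0 nat)" where
  "vec3 a b c = Poly_Mapping.single 1 a + Poly_Mapping.single 2 b + Poly_Mapping.single 3 c"

lemma lookup_vec3 [simp]:
  "Poly_Mapping.lookup (vec3 a b c) 1 = a"
  "Poly_Mapping.lookup (vec3 a b c) 2 = b"
  "Poly_Mapping.lookup (vec3 a b c) 3 = c"
  by (auto simp: vec3_def lookup_add lookup_single when_def)

lemma vec3_eqI:
  "Poly_Mapping.lookup v 1 = a \<Longrightarrow> Poly_Mapping.lookup v 2 = b \<Longrightarrow> Poly_Mapping.lookup v 3 = c
    \<Longrightarrow> v = vec3 a b c"
proof (rule poly_mapping_eqI)
  fix i :: 3
  assume "Poly_Mapping.lookup v 1 = a" "Poly_Mapping.lookup v 2 = b" "Poly_Mapping.lookup v 3 = c"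
  then show "Poly_Mapping.lookup v i = Poly_Mapping.lookup (vec3 a b c) i"
    using exhaust_3[of i] by auto
qed

lemma cone_partitionable_exps3_disj:
  assumes "cone_partitionable k (exps3 P)" "cone_partitionable k (exps3 Q)"
    and "\<And>x y z. \<not> (P x y z \<and> Q x y z)"
  shows "cone_partitionable k (exps3 (\<lambda>x y z. P x y z \<or> Q x y z))"
proof -
  have "exps3 P \<inter> exps3 Q = {}"
    using assms(3) by (auto simp: exps3_def)
  moreover have "exps3 (\<lambda>x y z. P x y z \<or> Q x y z) = exps3 P \<union> exps3 Q"
    by (auto simp: exps3_def)
  ultimately show ?thesis
    using cone_partitionable_Un[OF assms(1,2)] by simp
qed

section \<open>Cylinders over planar upward closed sets\<close>

lemma cone_partitionable_quadrant:
  "cone_partitionable 2 (exps3 (\<lambda>x y z. a \<le> x \<and> b \<le> y \<and> c \<le> z))"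
proof -
  have "exps3 (\<lambda>x y z. a \<le> x \<and> b \<le> y \<and> c \<le> z) = cone (vec3 a b c) UNIV"
    by (auto simp: exps3_def mem_cone_iff forall_3)
  then show ?thesis by (simp add: cone_partitionable_cone)
qed

text \<open>A column of a planar upward closed set is empty or a ray from its least point; the free
  third coordinate makes the ray a two-dimensional cone.\<close>

lemma cone_partitionable_column:
  assumes "\<And>y y'. Q y \<Longrightarrow> y \<le> y' \<Longrightarrow> Q y'"
  shows "cone_partitionable 2 (exps3 (\<lambda>x y z. x = a \<and> Q y \<and> c \<le> z))"
proof (cases "\<exists>y. Q y")
  case True
  then have "Q = (\<lambda>y. (LEAST y. Q y) \<le> y)"
    by (metis LeastI Least_le assms)
  then obtain n where "Q = (\<lambda>y. n \<le> y)" ..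
  then have "exps3 (\<lambda>x y z. x = a \<and> Q y \<and> c \<le> z) = cone (vec3 a n c) {2, 3}"
    by (auto simp: exps3_def mem_cone_iff forall_3)
  then show ?thesis by (simp add: cone_partitionable_cone)
next
  case False
  then show ?thesis by (simp add: exps3_def cone_partitionable_empty)
qed

lemma cone_partitionable_row:
  assumes "\<And>x x'. Q x \<Longrightarrow> x \<le> x' \<Longrightarrow> Q x'"
  shows "cone_partitionable 2 (exps3 (\<lambda>x y z. y = b \<and> Q x \<and> c \<le> z))"
proof (cases "\<exists>x. Q x")
  case True
  then have "Q = (\<lambda>x. (LEAST x. Q x) \<le> x)"
    by (metis LeastI Least_le assms)
  then obtain n where "Q = (\<lambda>x. n \<le> x)" ..
  then have "exps3 (\<lambda>x y z. y = b \<and> Q x \<and> c \<le> z) = cone (vec3 n b c) {1, 3}"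
    by (auto simp: exps3_def mem_cone_iff forall_3)
  then show ?thesis by (simp add: cone_partitionable_cone)
next
  case False
  then show ?thesis by (simp add: exps3_def cone_partitionable_empty)
qed

lemma cone_partitionable_columns:
  assumes "\<And>x y y'. Q x y \<Longrightarrow> y \<le> y' \<Longrightarrow> Q x y'"
  shows "cone_partitionable 2 (exps3 (\<lambda>x y z. x < p \<and> Q x y \<and> c \<le> z))"
proof (induction p)
  case (Suc p)
  have "cone_partitionable 2 (exps3 (\<lambda>x y z. x < p \<and> Q x y \<and> c \<le> z \<or> x = p \<and> Q p y \<and> c \<le> z))"
    using assms by (intro cone_partitionable_exps3_disj Suc cone_partitionable_column) auto
  moreover have "(\<lambda>x y z. x < Suc p \<and> Q x y \<and> c \<le> z)
      = (\<lambda>x y z. x < p \<and> Q x y \<and> c \<le> z \<or> x = p \<and> Q p y \<and> c \<le> z)"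
    by (auto simp: fun_eq_iff less_Suc_eq)
  ultimately show ?case by simp
qed (simp add: exps3_def cone_partitionable_empty)

lemma cone_partitionable_rows:
  assumes "\<And>x x' y. Q x y \<Longrightarrow> x \<le> x' \<Longrightarrow> Q x' y"
  shows "cone_partitionable 2 (exps3 (\<lambda>x y z. y < q \<and> Q x y \<and> c \<le> z))"
proof (induction q)
  case (Suc q)
  have "cone_partitionable 2 (exps3 (\<lambda>x y z. y < q \<and> Q x y \<and> c \<le> z \<or> y = q \<and> Q x q \<and> c \<le> z))"
    using assms by (intro cone_partitionable_exps3_disj Suc cone_partitionable_row) auto
  moreover have "(\<lambda>x y z. y < Suc q \<and> Q x y \<and> c \<le> z)
      = (\<lambda>x y z. y < q \<and> Q x y \<and> c \<le> z \<or> y = q \<and> Q x q \<and> c \<le> z)"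
    by (auto simp: fun_eq_iff less_Suc_eq)
  ultimately show ?case by simp
qed (simp add: exps3_def cone_partitionable_empty)

text \<open>Let \<open>b\<close> be the least second coordinate, attained at \<open>(n, b)\<close>.
  From column \<open>n\<close> on, the planar set is the whole quadrant at \<open>(n, b)\<close>; to
  the left of it only finitely many columns remain.\<close>

lemma cone_partitionable_cylinder:
  assumes up: "\<And>x y x' y'. Q x y \<Longrightarrow> x \<le> x' \<Longrightarrow> y \<le> y' \<Longrightarrow> Q x' y'"
  shows "cone_partitionable 2 (exps3 (\<lambda>x y z. Q x y \<and> c \<le> z))"
proof (cases "\<exists>x y. Q x y")
  case True
  define b where "b = (LEAST y. \<exists>x. Q x y)"
  have "\<exists>x. Q x b"
    unfolding b_def by (rule LeastI_ex) (use True in blast)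
  then obtain n where n: "Q n b" ..
  have b: "b \<le> y" if "Q x y" for x y
    unfolding b_def by (rule Least_le) (use that in blast)
  have columns: "cone_partitionable 2 (exps3 (\<lambda>x y z. x < n \<and> Q x y \<and> c \<le> z))"
    by (rule cone_partitionable_columns) (erule up; simp)
  have "cone_partitionable 2 (exps3 (\<lambda>x y z. x < n \<and> Q x y \<and> c \<le> z \<or> n \<le> x \<and> b \<le> y \<and> c \<le> z))"
    by (rule cone_partitionable_exps3_disj[OF columns cone_partitionable_quadrant]) simp
  moreover have "Q x y \<longleftrightarrow> x < n \<and> Q x y \<or> n \<le> x \<and> b \<le> y" for x y
    using b[of x y] up[OF n, of x y] by linarith
  then have "(\<lambda>x y z. Q x y \<and> c \<le> z)
      = (\<lambda>x y z. x < n \<and> Q x y \<and> c \<le> z \<or> n \<le> x \<and> b \<le> y \<and> c \<le> z)"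
    by (intro ext) blast
  ultimately show ?thesis by simp
next
  case False
  then show ?thesis by (simp add: exps3_def cone_partitionable_empty)
qed

section \<open>Slicing by the third exponent\<close>

locale saturated_upset =
  fixes P :: "nat \<Rightarrow> nat \<Rightarrow> nat \<Rightarrow> bool"
  assumes up: "P x y z \<Longrightarrow> x \<le> x' \<Longrightarrow> y \<le> y' \<Longrightarrow> z \<le> z' \<Longrightarrow> P x' y' z'"
    and saturated: "P x' y z \<Longrightarrow> P x y' z \<Longrightarrow> P x y z' \<Longrightarrow> P x y z"
begin

text \<open>With \<open>p\<close> and \<open>q\<close> the least coordinates occurring in layer \<open>c\<close>, saturation shows that no
  point of the quadrant at \<open>(p, q)\<close> is new in layer \<open>c + 1\<close>; the new points therefore lie on
  finitely many columns and rows that miss layer \<open>c\<close> altogether.\<close>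

lemma cone_partitionable_new_points:
  "cone_partitionable 2 (exps3 (\<lambda>x y z. (P x y (Suc c) \<and> \<not> P x y c) \<and> Suc c \<le> z))"
proof (cases "\<exists>x y. P x y c")
  case True
  define p where "p = (LEAST x. \<exists>y. P x y c)"
  define q where "q = (LEAST y. \<exists>x. P x y c)"
  have "\<exists>y. P p y c"
    unfolding p_def using True by (rule LeastI_ex)
  then obtain b where b: "P p b c" ..
  have "\<exists>x. P x q c"
    unfolding q_def by (rule LeastI_ex) (use True in blast)
  then obtain a where a: "P a q c" ..
  have p: "p \<le> x" if "P x y c" for x y
    unfolding p_def by (rule Least_le) (use that in blast)
  have q: "q \<le> y" if "P x y c" for x y
    unfolding q_def by (rule Least_le) (use that in blast)
  \<comment> \<open>The point \<open>(a, q)\<close> of layer \<open>c\<close> moves up to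
    \<open>(a, y)\<close>, and \<open>(p, b)\<close> moves right to \<open>(x, b)\<close>. Thus
    \<open>(x, y, c)\<close> reaches the set in all three directions.\<close>
  have old: "P x y c" if "P x y (Suc c)" "p \<le> x" "q \<le> y" for x y
    using up[OF a order_refl that(3) order_refl] up[OF b that(2) order_refl order_refl] that(1)
    by (rule saturated)
  \<comment> \<open>The condition \<open>p \<le> x\<close> in the rows keeps them disjoint from the
    columns. Newness is automatic here, since layer \<open>c\<close> has no point with
    \<open>x < p\<close> or \<open>y < q\<close>.\<close>
  have "cone_partitionable 2 (exps3 (\<lambda>x y z. x < p \<and> P x y (Suc c) \<and> Suc c \<le> z \<or>
      y < q \<and> (p \<le> x \<and> P x y (Suc c)) \<and> Suc c \<le> z))"
  proof (intro cone_partitionable_exps3_disj cone_partitionable_columns cone_partitionable_rows)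
    show "P x y' (Suc c)" if "P x y (Suc c)" "y \<le> y'" for x y y'
      by (rule up[OF that(1)]) (use that in auto)
    show "p \<le> x' \<and> P x' y (Suc c)" if "p \<le> x \<and> P x y (Suc c)" "x \<le> x'" for x x' y
      using that up[of x y "Suc c" x' y "Suc c"] by simp
  qed auto
  moreover have "P x y (Suc c) \<and> \<not> P x y c \<longleftrightarrow>
      x < p \<and> P x y (Suc c) \<or> y < q \<and> (p \<le> x \<and> P x y (Suc c))" for x y
    using p[of x y] q[of x y] old[of x y] by linarith
  then have "(\<lambda>x y z. (P x y (Suc c) \<and> \<not> P x y c) \<and> Suc c \<le> z) =
      (\<lambda>x y z. x < p \<and> P x y (Suc c) \<and> Suc c \<le> z \<or> y < q \<and> (p \<le> x \<and> P x y (Suc c)) \<and> Suc c \<le> z)"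
    by (intro ext) blast
  ultimately show ?thesis by simp
next
  case False
  \<comment> \<open>Layer \<open>c\<close> is empty, so all of layer \<open>c + 1\<close> is new;
    this is where a quadrant can arise.\<close>
  moreover have "cone_partitionable 2 (exps3 (\<lambda>x y z. P x y (Suc c) \<and> Suc c \<le> z))"
    by (rule cone_partitionable_cylinder) (erule up; simp)
  ultimately show ?thesis by simp
qed

text \<open>The set here is \<open>P\<close> with its layers frozen from level \<open>c\<close> on.
  Raising \<open>c\<close> by one adds exactly the cylinder over the points that are new in layer
  \<open>c + 1\<close>.\<close>

lemma cone_partitionable_layers: "cone_partitionable 2 (exps3 (\<lambda>x y z. P x y (min z c)))"
proof (induction c)
  case 0
  have "cone_partitionable 2 (exps3 (\<lambda>x y z. P x y 0 \<and> 0 \<le> z))"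
    by (rule cone_partitionable_cylinder) (erule up; simp)
  then show ?case by simp
next
  case (Suc c)
  have "cone_partitionable 2 (exps3 (\<lambda>x y z. P x y (min z c) \<or>
      (P x y (Suc c) \<and> \<not> P x y c) \<and> Suc c \<le> z))"
    by (intro cone_partitionable_exps3_disj Suc cone_partitionable_new_points) (auto simp: min_def)
  moreover have "P x y (min z (Suc c)) \<longleftrightarrow>
      P x y (min z c) \<or> (P x y (Suc c) \<and> \<not> P x y c) \<and> Suc c \<le> z" for x y z
    using up[of x y c x y "Suc c"] by (cases "z \<le> c") (auto simp: min_def le_Suc_eq)
  ultimately show ?case by simp
qed

text \<open>By saturation, the layers are constant from the first one on which both least coordinates
  of the whole set are attained.\<close>

lemma cone_partitionable: "cone_partitionable 2 (exps3 P)"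
proof (cases "\<exists>x y z. P x y z")
  case True
  define p where "p = (LEAST x. \<exists>y z. P x y z)"
  define q where "q = (LEAST y. \<exists>x z. P x y z)"
  have "\<exists>y z. P p y z"
    unfolding p_def using True by (rule LeastI_ex)
  then obtain b c where b: "P p b c" by blast
  have "\<exists>x z. P x q z"
    unfolding q_def by (rule LeastI_ex) (use True in blast)
  then obtain a c' where a: "P a q c'" by blast
  have p: "p \<le> x" if "P x y z" for x y z
    unfolding p_def by (rule Least_le) (use that in blast)
  have q: "q \<le> y" if "P x y z" for x y z
    unfolding q_def by (rule Least_le) (use that in blast)
  \<comment> \<open>By level \<open>n\<close> both least coordinates \<open>p\<close> and
    \<open>q\<close> have appeared, so \<open>P p b n\<close> and \<open>P a q n\<close>
    hold.\<close>
  define n where "n = max c c'"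
  have "P x y (min z n)" if "P x y z" for x y z
  proof (cases "z \<le> n")
    case False
    have "P a y n"
      using a by (rule up) (use q[OF that] in \<open>auto simp: n_def\<close>)
    moreover have "P x b n"
      using b by (rule up) (use p[OF that] in \<open>auto simp: n_def\<close>)
    ultimately have "P x y n"
      using that by (rule saturated)
    with False show ?thesis by simp
  qed (use that in simp)
  moreover have "P x y z" if "P x y (min z n)" for x y z
    using that by (rule up) auto
  ultimately have "P = (\<lambda>x y z. P x y (min z n))"
    by (intro ext) blast
  with cone_partitionable_layers[of n] show ?thesis by simp
next
  case False
  then show ?thesis by (simp add: exps3_def cone_partitionable_empty)
qed

end

lemma saturated_cone_partitionable:
  fixes U :: "(3 \<Rightarrow>\<^sub>0 nat) set"
  assumes closed: "add_closed U"
    and sat: "(polys_on U :: (3, 'k::field) mpoly set) = saturation (polys_on U)"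
  shows "cone_partitionable 2 U"
proof -
  have move: "vec3 x' y' z' \<in> U" if "vec3 x y z \<in> U" "x \<le> x'" "y \<le> y'" "z \<le> z'" for x y z x' y' z'
  proof -
    have "vec3 x' y' z' = vec3 x y z + vec3 (x' - x) (y' - y) (z' - z)"
      by (rule vec3_eqI[symmetric]) (use that in \<open>simp_all add: lookup_add\<close>)
    with that(1) closed show ?thesis
      unfolding add_closed_def by metis
  qed
  interpret saturated_upset "\<lambda>x y z. vec3 x y z \<in> U"
  proof
    fix x y z x' y' z'
    assume x: "vec3 x' y z \<in> U" and y: "vec3 x y' z \<in> U" and z: "vec3 x y z' \<in> U"
    \<comment> \<open>The coordinate \<open>x'\<close> may be smaller than \<open>x\<close>, so it
      is used as the displacement: \<open>x + x'\<close> is at least \<open>x'\<close>, and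
      \<open>move\<close> applies. The other two directions are treated alike.\<close>
    have "vec3 x y z + Poly_Mapping.single 1 x' = vec3 (x + x') y z"
      "vec3 x y z + Poly_Mapping.single 2 y' = vec3 x (y + y') z"
      "vec3 x y z + Poly_Mapping.single 3 z' = vec3 x y (z + z')"
      by (rule vec3_eqI; simp add: lookup_add lookup_single when_def)+
    moreover have "vec3 (x + x') y z \<in> U" "vec3 x (y + y') z \<in> U" "vec3 x y (z + z') \<in> U"
      using move[OF x] move[OF y] move[OF z] by auto
    ultimately have "\<forall>i. \<exists>k. vec3 x y z + Poly_Mapping.single i k \<in> U"
      unfolding forall_3 by metis
    then show "vec3 x y z \<in> U"
      using saturated_polys_on[OF closed sat] by blast
  qed (rule move)
  have "exps3 (\<lambda>x y z. vec3 x y z \<in> U) = U"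
    unfolding exps3_def using vec3_eqI[OF refl refl refl] by auto
  with cone_partitionable show ?thesis by simp
qed


section \<open>Decompositions into full-dimensional Stanley spaces\<close>

text \<open>The multidegree fixes every coordinate of an exponent, so at most one term can
  occur.\<close>

lemma graded_component_eq_single:
  fixes m :: "('x, 'k::field) mpoly"
  assumes "m \<in> graded_component d"
  obtains v c where "m = Poly_Mapping.single v c"
proof (cases "m = 0")
  case True
  with that[of 0 0] show ?thesis by simp
next
  case False
  then obtain v where v: "Poly_Mapping.lookup m v \<noteq> 0"
    by (metis lookup_zero poly_mapping_eqI)
  have "w = v" if "w \<in> Poly_Mapping.keys m" for w
  proof (rule poly_mapping_eqI)
    fix i
    have "int (Poly_Mapping.lookup w i) = int (Poly_Mapping.lookup v i)"
      using assms that v by (simp add: graded_component_def in_keys_iff)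
    then show "Poly_Mapping.lookup w i = Poly_Mapping.lookup v i" by simp
  qed
  then have "m = Poly_Mapping.single v (Poly_Mapping.lookup m v)"
    by (intro poly_mapping_eqI) (auto simp: lookup_single when_def in_keys_iff)
  then show ?thesis by (rule that)
qed

text \<open>Summands with \<open>m = 0\<close> do satisfy the definition, as
  the zero module is free on the empty basis.\<close>

lemma stanley_decomposition_card_less:
  fixes M :: "('x::finite, 'k::field) mpoly set"
  assumes D: "stanley_decomposition (*) (\<lambda>d. M \<inter> graded_component d) M D"
    and M: "\<not> principal_ideal M"
  obtains m Z where "(m, Z) \<in> set D" "card Z < CARD('x)"
proof (rule ccontr)
  interpret module "(*) :: ('x, 'k) mpoly \<Rightarrow> _" by (rule module_mult)
  assume "\<not> thesis"
  with that have "card Z = CARD('x)" if "(m, Z) \<in> set D" for m Z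
    using that by (metis card_mono finite_class.finite_UNIV le_neq_implies_less subset_UNIV)
  then have Z: "snd (D ! i) = UNIV" if "i < length D" for i
    using that by (metis card_eq_UNIV_imp_eq_UNIV finite_class.finite_UNIV nth_mem prod.collapse)
  define m where "m i = fst (D ! i)" for i
  let ?V = "\<lambda>i. stanley_space (*) (m i) (UNIV :: 'x set)"
  have V: "?V i = range (\<lambda>f. f * m i)" for i
    by (simp add: stanley_space_def polys_in_def)
  have "Pi\<^sub>E {..<length D} (\<lambda>i. stanley_space (*) (fst (D ! i)) (snd (D ! i))) = Pi\<^sub>E {..<length D} ?V"
    by (rule PiE_cong) (simp add: Z m_def)
  then have bij: "bij_betw (\<lambda>s. \<Sum>i<length D. s i) (Pi\<^sub>E {..<length D} ?V) M"
    using D by (simp add: stanley_decomposition_def is_direct_sum_def)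
  have zero: "0 \<in> ?V i" for i
    unfolding V by (rule range_eqI[of _ _ 0]) simp
  \<comment> \<open>The tuple with \<open>g\<close> at position \<open>i\<close> and zeros
    elsewhere; comparing two such tuples tests whether summands intersect only in 0.\<close>
  define e where "e i g = (\<lambda>j\<in>{..<length D}. if j = i then g else 0)" for i and g :: "('x, 'k) mpoly"
  have e: "e i g \<in> Pi\<^sub>E {..<length D} ?V" if "g \<in> ?V i" for i g
    using that zero by (auto simp: e_def)
  have sum_e: "(\<Sum>j<length D. e i g j) = g" if "i < length D" for i g
    using that by (simp add: e_def)
  have unique: "m j = 0" if ij: "i < length D" "j < length D" "i \<noteq> j" "m i \<noteq> 0" for i j
  proof (rule ccontr)
    assume j: "m j \<noteq> 0"
    have "\<exists>d. m k \<in> graded_component d" if "k < length D" for k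
      using D nth_mem[OF that] by (cases "D ! k") (fastforce simp: stanley_decomposition_def m_def)
    then obtain d d' where "m i \<in> graded_component d" "m j \<in> graded_component d'"
      using ij by blast
    then obtain v c w c' where vw: "m i = Poly_Mapping.single v c" "m j = Poly_Mapping.single w c'"
      by (elim graded_component_eq_single)
    \<comment> \<open>The product lies in both summands, so directness forces it to be 0. Both
      factors are single terms with nonzero coefficients, which is impossible over a field.\<close>
    have "m j * m i \<in> ?V i"
      unfolding V by (rule range_eqI[of _ _ "m j"]) simp
    moreover have "m j * m i \<in> ?V j"
      unfolding V by (rule range_eqI[of _ _ "m i"]) (simp add: mult.commute)
    ultimately have "e i (m j * m i) = e j (m j * m i)"
      by (intro inj_onD[OF bij_betw_imp_inj_on[OF bij]] e) (simp_all add: sum_e ij(1,2))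
    then have "e i (m j * m i) i = e j (m j * m i) i" by simp
    then have "m j * m i = 0"
      using ij by (simp add: e_def)
    then have "c' * c = 0"
      unfolding vw by (metis lookup_single_eq lookup_zero mult_single)
    with j ij(4) vw show False by auto
  qed
  \<comment> \<open>A nonzero \<open>m i\<close> is the only nonzero one and generates
    \<open>M\<close>. If there is none, which covers the empty list, then \<open>M\<close> is the
    zero ideal with generator 0.\<close>
  obtain g where g: "M = range (\<lambda>f. f * g)"
  proof (cases "\<exists>i<length D. m i \<noteq> 0")
    case True
    then obtain i where i: "i < length D" "m i \<noteq> 0" by blast
    have "M = ?V i"
    proof (intro equalityI subsetI)
      fix f assume "f \<in> M"
      then obtain s where s: "s \<in> Pi\<^sub>E {..<length D} ?V" "f = (\<Sum>j<length D. s j)"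
        using bij_betw_imp_surj_on[OF bij] by blast
      have "s j = 0" if "j < length D" "j \<noteq> i" for j
      proof -
        have "s j \<in> ?V j" using s(1) that by auto
        then show ?thesis
          unfolding V using unique[OF i(1) that(1) _ i(2)] that(2) by auto
      qed
      then have "f = (\<Sum>j<length D. if j = i then s i else 0)"
        unfolding s(2) by (intro sum.cong) auto
      then show "f \<in> ?V i"
        using i s(1) by auto
    next
      fix f assume "f \<in> ?V i"
      then have "(\<Sum>j<length D. e i f j) \<in> M"
        using bij_betwE[OF bij] e by blast
      then show "f \<in> M"
        by (simp add: sum_e[OF i(1)])
    qed
    then show ?thesis using V that by simp
  next
    case False
    have "M = (\<lambda>s. \<Sum>i<length D. s i) ` (Pi\<^sub>E {..<length D} (\<lambda>i. {0}))"
      unfolding bij_betw_imp_surj_on[OF bij, symmetric]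
    proof (intro arg_cong2[where f = image] refl PiE_cong)
      show "?V i = {0}" if "i \<in> {..<length D}" for i
        unfolding V using False that by auto
    qed
    then have "M = {0}"
      by (auto simp: PiE_singleton)
    then have "M = range (\<lambda>f. f * 0)" by auto
    then show ?thesis by (rule that)
  qed
  then have "principal_ideal M"
    unfolding principal_ideal_def span_singleton by blast
  with M show False by contradiction
qed

theorem proposition3p2:
  fixes I :: "(3, 'k::field) mpoly set"
  assumes "monomial_ideal I"
    and "\<not> principal_ideal I"
    and "I = saturation I"
  shows "ideal_sdepth I = 2"
proof -
  let ?S = "{decomposition_sdepth D | D. stanley_decomposition (*) (\<lambda>d. I \<inter> graded_component d) I D}"
  \<comment> \<open>Nonemptiness is recorded because the later lower bound on \<open>Min\<close>
    needs a nonempty set. It holds because \<open>I\<close> is not principal.\<close>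
  have le: "set D \<noteq> {} \<and> decomposition_sdepth D \<le> 2"
    if D: "stanley_decomposition (*) (\<lambda>d. I \<inter> graded_component d) I D" for D
  proof -
    obtain m Z where mZ: "(m, Z) \<in> set D" "card Z < CARD(3)"
      using stanley_decomposition_card_less[OF D assms(2)] by blast
    then have "decomposition_sdepth D \<le> card Z"
      unfolding decomposition_sdepth_def by (intro Min_le) force+
    with mZ show ?thesis by auto
  qed
  obtain U where U: "add_closed U" "I = polys_on U"
    using monomial_ideal_polys_on[OF assms(1)] by blast
  have "cone_partitionable 2 U"
    using U assms(3) by (intro saturated_cone_partitionable) simp_all
  then obtain D where D: "stanley_decomposition (*) (\<lambda>d. I \<inter> graded_component d) I D"
      "\<forall>(m, Z)\<in>set D. 2 \<le> card Z"
    using cone_partitionable_stanley_decomposition U(2) by metis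
  have "2 \<le> decomposition_sdepth D"
    unfolding decomposition_sdepth_def using D(2) le[OF D(1)] by (subst Min_ge_iff) auto
  then have "decomposition_sdepth D = 2"
    using le[OF D(1)] by simp
  with D(1) have "2 \<in> ?S" by force
  moreover have "\<forall>n\<in>?S. n \<le> 2" using le by auto
  \<comment> \<open>\<open>Max\<close> is meaningful only for finite sets; here finiteness follows
    from the bound 2.\<close>
  moreover from this have "finite ?S" by (meson finite_nat_set_iff_bounded_le)
  ultimately show ?thesis
    unfolding ideal_sdepth_def sdepth_def by (intro Max_eqI) auto
qed

end
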